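(* Let $P_n(x)=\sum_{\sigma\in\mathfrak{S}_n}x^{\mathrm{wexx}(\sigma)}$ and $Q_n(x)=\sum_{\sigma\in\mathfrak{S}_n}x^{\mathrm{cdes}(\sigma)}$. Then both $\sum_{n\ge0}P_n(x)t^n$ and $\sum_{n\ge0}Q_n(x)t^n$ equal the Jacobi-type continued fraction $$\cfrac{1}{1-1\cdot t-\cfrac{1\cdot1\,t^2}{1-(2+x)t-\cfrac{2(1+x)t^2}{1-(3+2x)t-\cfrac{3(1+2x)t^2}{1-\cdots}}}}$$ with coefficients $\gamma_n=(n+1)+nx$ for $n\ge0$ and $\beta_n=n\,(1+(n-1)x)$ for $n\ge1$. Consequently $P_n(x)=Q_n(x)$ for all $n\ge0$, i.e. the statistics wexx and cdes are equidistributed on $\mathfrak{S}_n$.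
   Context: $\mathfrak{S}_n$ is the set of permutations of $[n]$. $\mathrm{wexx}(\sigma)$ is the number of $j\in[n]$ with $j\le\sigma(j)$ such that there exist $i<j<k$ with $\sigma(i)>\sigma(j)>\sigma(k)$ (weak excedances that are midpoints of a decreasing subsequence of length 3). $\mathrm{cdes}(\sigma)$ (cycle descent number) is the number of $i\in[n]$ with $i>\sigma(i)$ such that $\sigma(i)$ is not the smallest element of its cycle. The Jacobi-type continued fraction with coefficients $(\gamma_n)_{n\ge0},(\beta_n)_{n\ge1}$ is $1/(1-\gamma_0t-\beta_1t^2/(1-\gamma_1t-\beta_2t^2/(1-\cdots)))$. *)

theory Defs
  imports
    "HOL-Computational_Algebra.Polynomial"
    "HOL-Computational_Algebra.Formal_Power_Series"
    "HOL-Combinatorics.Orbits"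
begin

text \<open>A permutation of \<open>[n]\<close> is a function \<open>\<sigma> :: nat \<Rightarrow> nat\<close> with
  \<open>\<sigma> permutes {1..n}\<close>.\<close>

definition wexx :: "nat \<Rightarrow> (nat \<Rightarrow> nat) \<Rightarrow> nat" where
  "wexx n \<sigma> = card {j \<in> {1..n}. j \<le> \<sigma> j \<and>
     (\<exists>i\<in>{1..n}. \<exists>k\<in>{1..n}. i < j \<and> j < k \<and> \<sigma> i > \<sigma> j \<and> \<sigma> j > \<sigma> k)}"

definition cdes :: "nat \<Rightarrow> (nat \<Rightarrow> nat) \<Rightarrow> nat" where
  "cdes n \<sigma> = card {i \<in> {1..n}. i > \<sigma> i \<and> \<sigma> i \<noteq> Min (orbit \<sigma> (\<sigma> i))}"

text \<open>The indeterminate \<open>x\<close> of the polynomial ring.\<close>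

abbreviation poly_x :: "int poly" where
  "poly_x \<equiv> [:0, 1:]"

definition wexx_poly :: "nat \<Rightarrow> int poly" where
  "wexx_poly n = (\<Sum>\<sigma> | \<sigma> permutes {1..n}. poly_x ^ wexx n \<sigma>)"

definition cdes_poly :: "nat \<Rightarrow> int poly" where
  "cdes_poly n = (\<Sum>\<sigma> | \<sigma> permutes {1..n}. poly_x ^ cdes n \<sigma>)"

text \<open>The \<open>N\<close>-th convergent of the Jacobi-type continued fraction, obtained by truncating
  after \<open>N\<close> levels (the remaining tail is replaced by \<open>0\<close>). The value \<open>\<beta> 0\<close> is never used.
  The coefficient ring need not be a field: every denominator has constant term 1, and
  \<open>fps_right_inverse f 1\<close> is the reciprocal of such an \<open>f\<close>.\<close>

primrec jfrac_convergent ::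
    "(nat \<Rightarrow> 'a::comm_ring_1) \<Rightarrow> (nat \<Rightarrow> 'a) \<Rightarrow> nat \<Rightarrow> 'a fps" where
  "jfrac_convergent \<gamma> \<beta> 0 = 0"
| "jfrac_convergent \<gamma> \<beta> (Suc N) =
     fps_right_inverse
       (1 - fps_const (\<gamma> 0) * fps_X
          - fps_const (\<beta> 1) * fps_X ^ 2
            * jfrac_convergent (\<lambda>n. \<gamma> (Suc n)) (\<lambda>n. \<beta> (Suc n)) N) 1"

text \<open>The infinite continued fraction is the limit of its convergents in the
  \<open>t\<close>-adic topology; the limit always exists, see below.\<close>

definition jfrac :: "(nat \<Rightarrow> 'a::comm_ring_1) \<Rightarrow> (nat \<Rightarrow> 'a) \<Rightarrow> 'a fps" where
  "jfrac \<gamma> \<beta> = lim (jfrac_convergent \<gamma> \<beta>)"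

context includes fps_syntax
begin

lemma jfrac_convergent_Suc_mult:
  "(1 - fps_const (\<gamma> 0) * fps_X
      - fps_const (\<beta> 1) * fps_X ^ 2
        * jfrac_convergent (\<lambda>n. \<gamma> (Suc n)) (\<lambda>n. \<beta> (Suc n)) N)
   * jfrac_convergent \<gamma> \<beta> (Suc N) = 1"
  unfolding jfrac_convergent.simps
  by (rule fps_right_inverse) (simp add: power2_eq_square mult.assoc)

lemma jfrac_convergent_stable:
  "n < N \<Longrightarrow> jfrac_convergent \<gamma> \<beta> (Suc N) $ n = jfrac_convergent \<gamma> \<beta> N $ n"
proof (induction N arbitrary: \<gamma> \<beta> n)
  case 0
  then show ?case by simp
next
  case (Suc N)
  let ?\<gamma> = "\<lambda>n. \<gamma> (Suc n)" and ?\<beta> = "\<lambda>n. \<beta> (Suc n)"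
  define a where "a = jfrac_convergent ?\<gamma> ?\<beta> N"
  define b where "b = jfrac_convergent ?\<gamma> ?\<beta> (Suc N)"
  define A where "A = jfrac_convergent \<gamma> \<beta> (Suc N)"
  define B where "B = jfrac_convergent \<gamma> \<beta> (Suc (Suc N))"
  define D where "D = 1 - fps_const (\<gamma> 0) * fps_X"
  define c where "c = fps_const (\<beta> 1) * (fps_X :: 'a fps) ^ 2"
  have A: "(D - c * a) * A = 1"
    unfolding A_def a_def D_def c_def by (rule jfrac_convergent_Suc_mult)
  have B: "(D - c * b) * B = 1"
    unfolding B_def b_def D_def c_def by (rule jfrac_convergent_Suc_mult)
  have "B - A = ((D - c * a) * A) * B - ((D - c * b) * B) * A"
    by (simp only: A B mult_1_left)
  also have "\<dots> = fps_X * ((fps_const (\<beta> 1) * fps_X * A * B) * (b - a))"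
    by (simp add: c_def algebra_simps power2_eq_square)
  finally have BA: "B - A = fps_X * ((fps_const (\<beta> 1) * fps_X * A * B) * (b - a))" .
  have "(b - a) $ m = 0" if "m < N" for m
    using Suc.IH[OF that, of ?\<gamma> ?\<beta>] by (simp add: a_def b_def)
  then have "(F * (b - a)) $ m = 0" if "m < N" for m and F :: "'a fps"
    using that by (simp add: fps_mult_nth)
  then have "(B - A) $ n = 0"
    unfolding BA using Suc.prems by (cases n) auto
  then show ?case by (simp add: A_def B_def)
qed

lemma jfrac_convergent_nth:
  assumes "n < N"
  shows "jfrac_convergent \<gamma> \<beta> N $ n = jfrac_convergent \<gamma> \<beta> (Suc n) $ n"
proof -
  have "Suc n \<le> N" using assms by simp
  then show ?thesis
  proof (induction N rule: dec_induct)
    case (step M)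
    then have "n < M" by simp
    from jfrac_convergent_stable[OF this, of \<gamma> \<beta>] step.IH show ?case by (rule trans)
  qed (rule refl)
qed

lemma jfrac_convergent_LIMSEQ: "jfrac_convergent \<gamma> \<beta> \<longlonglongrightarrow> jfrac \<gamma> \<beta>"
proof -
  have "jfrac_convergent \<gamma> \<beta> \<longlonglongrightarrow> Abs_fps (\<lambda>n. jfrac_convergent \<gamma> \<beta> (Suc n) $ n)"
  proof (rule tendsto_fpsI)
    fix n
    show "\<forall>\<^sub>F N in sequentially. jfrac_convergent \<gamma> \<beta> N $ n
        = Abs_fps (\<lambda>n. jfrac_convergent \<gamma> \<beta> (Suc n) $ n) $ n"
      using eventually_gt_at_top[of n]
      by eventually_elim (simp only: fps_nth_Abs_fps, rule jfrac_convergent_nth)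
  qed
  then show ?thesis
    unfolding jfrac_def by (metis limI)
qed

end

end

theory Submission
  imports Defs
begin

text \<open>Read the rook placement \<open>{(i, \<sigma> i)}\<close> of a permutation through its corners \<open>[m]\<^sup>2\<close>,
  \<open>m = 0, \<dots>, n\<close>. The number \<open>k\<close> of free rows (equally, free columns) of the corner traces a Motzkin
  path, so a statistic that splits into contributions depending only on the corners has a J-fraction
  as its generating function as soon as the total weight of the steps out of a placement depends on
  \<open>k\<close> alone.

  Every weak excedance \<open>j\<close> preceded by a larger value is, by counting, also followed by a smaller
  one, so \<open>wexx\<close> counts the weak excedances that are not left-to-right maxima. When the new column
  \<open>m\<close> is filled in one of \<open>k\<close> free rows, only the topmost of them makes \<open>m\<close> a left-to-right
  maximum, which gives \<open>1 + (k - 1) x\<close>.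

  Each nontrivial cycle has one drop to its minimum and one drop from its maximum, so \<open>cdes\<close> counts
  the drops \<open>i > \<sigma> i\<close> with \<open>i\<close> not maximal in its cycle. A placement is a union of cycles and \<open>k\<close>
  paths; joining the end of one of the paths to the start of another through \<open>m\<close> costs \<open>x\<close>, closing
  it up to a cycle costs \<open>1\<close>, which again gives \<open>1 + (k - 1) x\<close>.\<close>

section \<open>Sums and products of two-valued functions\<close>

lemma prod_if_power:
  "finite A \<Longrightarrow> (\<Prod>a\<in>A. if P a then x else 1) = (x :: 'a::comm_monoid_mult) ^ card {a \<in> A. P a}"
  by (simp add: prod.inter_filter[symmetric])

lemma sum_if_ex1_not:
  fixes x :: "'b::comm_ring_1"
  assumes "finite A" and unique: "\<exists>!a. a \<in> A \<and> \<not> P a"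
  shows "(\<Sum>a\<in>A. if P a then x else 1) = 1 + (of_nat (card A) - 1) * x"
proof -
  from unique obtain a where a: "a \<in> A" "\<not> P a" "\<forall>b\<in>A - {a}. P b" by blast
  then have "(\<Sum>b\<in>A. if P b then x else 1) = 1 + (\<Sum>b\<in>A - {a}. x)"
    using assms(1) by (simp add: sum.remove)
  moreover have "card A = Suc (card (A - {a}))"
    using assms(1) a(1) by (rule card.remove)
  ultimately show ?thesis by simp
qed

lemma sum_if_exists_smaller:
  fixes A :: "'a::linorder set" and x :: "'b::comm_ring_1"
  assumes "finite A" "A \<noteq> {}"
  shows "(\<Sum>a\<in>A. if \<exists>b\<in>A. b < a then x else 1) = 1 + (of_nat (card A) - 1) * x"
proof (rule sum_if_ex1_not[OF assms(1)], rule ex1I)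
  show "Min A \<in> A \<and> \<not> (\<exists>b\<in>A. b < Min A)"
    using assms by (auto simp: not_less)
  show "a = Min A" if "a \<in> A \<and> \<not> (\<exists>b\<in>A. b < a)" for a
    using that assms by (intro Min_eqI[symmetric]) (auto simp: not_less)
qed

lemma coeff_sum_X_power:
  "finite A \<Longrightarrow> coeff (\<Sum>a\<in>A. [:0, 1::'a::comm_semiring_1:] ^ f a) k = of_nat (card {a \<in> A. f a = k})"
  by (simp add: coeff_sum monom_altdef[of 1, simplified, symmetric] sum.inter_filter[symmetric])

section \<open>Motzkin paths and Jacobi-type continued fractions\<close>

text \<open>The total weight of the Motzkin paths of \<open>n\<close> steps from height \<open>k\<close> to height \<open>0\<close>, where the
  level and down steps that start at height \<open>i\<close> have weights \<open>\<gamma> i\<close> and \<open>\<beta> i\<close>, and the up steps have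
  weight \<open>1\<close>.\<close>

primrec motzkin_sum ::
    "(nat \<Rightarrow> 'a::comm_ring_1) \<Rightarrow> (nat \<Rightarrow> 'a) \<Rightarrow> nat \<Rightarrow> nat \<Rightarrow> 'a" where
  "motzkin_sum \<gamma> \<beta> 0 k = (if k = 0 then 1 else 0)"
| "motzkin_sum \<gamma> \<beta> (Suc n) k = motzkin_sum \<gamma> \<beta> n (Suc k) + \<gamma> k * motzkin_sum \<gamma> \<beta> n k
     + (if k = 0 then 0 else \<beta> k * motzkin_sum \<gamma> \<beta> n (k - 1))"

context includes fps_syntax
begin

lemma jfrac_nth:
  assumes "n < N"
  shows "jfrac \<gamma> \<beta> $ n = jfrac_convergent \<gamma> \<beta> N $ n"
proof -
  have "\<forall>\<^sub>F M in sequentially. jfrac_convergent \<gamma> \<beta> M $ n = jfrac \<gamma> \<beta> $ n"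
    using jfrac_convergent_LIMSEQ[of \<gamma> \<beta>] by (simp add: tendsto_fps_iff)
  then obtain M where "n < M" and M: "jfrac_convergent \<gamma> \<beta> M $ n = jfrac \<gamma> \<beta> $ n"
    using eventually_happens[OF eventually_conj[OF _ eventually_gt_at_top[of n]]] by auto
  have "jfrac \<gamma> \<beta> $ n = jfrac_convergent \<gamma> \<beta> (Suc n) $ n"
    using jfrac_convergent_nth[OF \<open>n < M\<close>, of \<gamma> \<beta>] M by simp
  also have "\<dots> = jfrac_convergent \<gamma> \<beta> N $ n"
    by (rule jfrac_convergent_nth[OF assms, symmetric])
  finally show ?thesis .
qed

lemma jfrac_unfold:
  "(1 - fps_const (\<gamma> 0) * fps_X
      - fps_const (\<beta> 1) * fps_X ^ 2 * jfrac (\<lambda>n. \<gamma> (Suc n)) (\<lambda>n. \<beta> (Suc n)))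
   * jfrac \<gamma> \<beta> = 1" (is "(?A - ?B * ?J') * ?J = 1")
proof (rule fps_ext)
  fix n
  let ?C' = "jfrac_convergent (\<lambda>n. \<gamma> (Suc n)) (\<lambda>n. \<beta> (Suc n)) (Suc n)"
    and ?C = "jfrac_convergent \<gamma> \<beta> (Suc (Suc n))"
  have denominator: "(?A - ?B * ?J') $ i = (?A - ?B * ?C') $ i" if "i \<le> n" for i
  proof -
    have "(?B * ?J') $ i = (?B * ?C') $ i"
      unfolding fps_mult_nth[of ?B]
      by (intro sum.cong refl arg_cong2[of _ _ _ _ "(*)"] jfrac_nth) (use that in auto)
    then show ?thesis by simp
  qed
  have "((?A - ?B * ?J') * ?J) $ n = ((?A - ?B * ?C') * ?C) $ n"
    unfolding fps_mult_nth[of "?A - _"]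
    by (intro sum.cong refl arg_cong2[of _ _ _ _ "(*)"] jfrac_nth denominator) auto
  also have "\<dots> = 1 $ n"
    by (simp only: jfrac_convergent_Suc_mult)
  finally show "((?A - ?B * ?J') * ?J) $ n = 1 $ n" .
qed

lemma fps_nth_eq_motzkin_sum:
  assumes "\<And>k. P k = (if k = 0 then 1 else 0) + fps_X * (P (Suc k) + fps_const (\<gamma> k) * P k
      + (if k = 0 then 0 else fps_const (\<beta> k) * P (k - 1)))"
  shows "P k $ n = motzkin_sum \<gamma> \<beta> n k"
proof (induction n arbitrary: k)
  case 0
  show ?case by (subst assms) simp
next
  case (Suc n)
  show ?case by (subst assms) (simp add: Suc.IH)
qed

theorem jfrac_eq_motzkin_sum: "jfrac \<gamma> \<beta> = Abs_fps (\<lambda>n. motzkin_sum \<gamma> \<beta> n 0)"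
proof -
  define J where "J k = jfrac (\<lambda>n. \<gamma> (n + k)) (\<lambda>n. \<beta> (n + k))" for k
  \<comment> \<open>A path from height \<open>k\<close> to \<open>0\<close> splits at its first visits to \<open>k - 1, \<dots>, 0\<close>.\<close>
  define P where "P k = J 0 * (\<Prod>i=1..k. fps_const (\<beta> i) * fps_X * J i)" for k
  have J: "J k = 1 + fps_X * (fps_const (\<gamma> k) * J k
      + fps_const (\<beta> (Suc k)) * fps_X * J k * J (Suc k))" for k
    using jfrac_unfold[of "\<lambda>n. \<gamma> (n + k)" "\<lambda>n. \<beta> (n + k)"]
    by (simp add: J_def algebra_simps power2_eq_square)
  have P_Suc: "P (Suc k) = fps_const (\<beta> (Suc k)) * fps_X * J (Suc k) * P k" for k
    by (simp add: P_def algebra_simps)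
  have "P k = (if k = 0 then 1 else 0) + fps_X * (P (Suc k) + fps_const (\<gamma> k) * P k
      + (if k = 0 then 0 else fps_const (\<beta> k) * P (k - 1)))" for k
  proof (cases k)
    case 0
    then show ?thesis
      using J[of 0] by (simp add: P_def algebra_simps)
  next
    case (Suc l)
    have "P k = fps_const (\<beta> k) * fps_X * P l * J k"
      by (simp add: Suc P_Suc algebra_simps)
    also have "\<dots> = fps_const (\<beta> k) * fps_X * P l
        * (1 + fps_X * (fps_const (\<gamma> k) * J k + fps_const (\<beta> (Suc k)) * fps_X * J k * J (Suc k)))"
      by (subst J) (rule refl)
    also have "\<dots> = fps_X * (P (Suc k) + fps_const (\<gamma> k) * P k + fps_const (\<beta> k) * P l)"
      by (simp add: Suc P_Suc algebra_simps)
    finally show ?thesis by (simp add: Suc)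
  qed
  then have "P 0 $ n = motzkin_sum \<gamma> \<beta> n 0" for n
    by (rule fps_nth_eq_motzkin_sum)
  moreover have "jfrac \<gamma> \<beta> = P 0"
    by (simp add: P_def J_def)
  ultimately show ?thesis
    by (simp add: fps_eq_iff)
qed

end

section \<open>Rook placements\<close>

definition rook_placements :: "'a set \<Rightarrow> 'b set \<Rightarrow> ('a \<times> 'b) set set" where
  "rook_placements A B = {R. R \<subseteq> A \<times> B \<and> single_valued R \<and> single_valued (R\<inverse>)}"

lemma rook_placements_subset: "R \<in> rook_placements A B \<Longrightarrow> R \<subseteq> A \<times> B"
  by (simp add: rook_placements_def)

lemma finite_rook_placements: "finite A \<Longrightarrow> finite B \<Longrightarrow> finite (rook_placements A B)"
  by (rule finite_subset[of _ "Pow (A \<times> B)"]) (auto simp: rook_placements_def)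

lemma finite_rook_placement:
  "R \<in> rook_placements A B \<Longrightarrow> finite A \<Longrightarrow> finite B \<Longrightarrow> finite R"
  by (rule finite_subset[OF rook_placements_subset]) auto

lemma converse_in_rook_placements_iff:
  "R\<inverse> \<in> rook_placements B A \<longleftrightarrow> R \<in> rook_placements A B"
  by (auto simp: rook_placements_def)

lemma converse_insert: "(insert (a, b) R)\<inverse> = insert (b, a) (R\<inverse>)"
  by auto

lemma card_Domain_single_valued: "single_valued R \<Longrightarrow> card (Domain R) = card R"
  unfolding Domain_fst by (rule card_image) (auto simp: inj_on_def dest: single_valuedD)

lemma card_free_rows:
  assumes "R \<in> rook_placements A B" "finite A"
  shows "card (A - Domain R) = card A - card R"
proof -
  have "Domain R \<subseteq> A" "card (Domain R) = card R"
    using assms by (auto simp: rook_placements_def card_Domain_single_valued)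
  then show ?thesis
    using assms(2) by (simp add: card_Diff_subset finite_subset)
qed

lemma card_free_columns:
  assumes "R \<in> rook_placements A B" "finite B"
  shows "card (B - Range R) = card B - card R"
  using card_free_rows[of "R\<inverse>" B A] assms by (simp add: converse_in_rook_placements_iff)

lemma card_rook_placement_le:
  assumes "R \<in> rook_placements A B" "finite A"
  shows "card R \<le> card A"
proof -
  have "card (Domain R) \<le> card A"
    using assms by (intro card_mono) (auto simp: rook_placements_def)
  then show ?thesis
    using assms by (simp add: rook_placements_def card_Domain_single_valued)
qed

lemma bij_betw_insert_rook:
  assumes "a \<notin> A"
  shows "bij_betw (\<lambda>(R, b). insert (a, b) R) (SIGMA R:rook_placements A B. B - Range R)
    {S \<in> rook_placements (insert a A) B. a \<in> Domain S}"
proof (rule bij_betw_imageI)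
  have not_in_Domain: "(a, b) \<notin> R" if "R \<in> rook_placements A B" for R b
    using that assms by (auto simp: rook_placements_def)
  show "inj_on (\<lambda>(R, b). insert (a, b) R) (SIGMA R:rook_placements A B. B - Range R)"
  proof (rule inj_onI, clarify)
    fix R R' b b'
    assume "R \<in> rook_placements A B" "R' \<in> rook_placements A B"
      and "insert (a, b) R = insert (a, b') R'"
    with not_in_Domain show "R = R' \<and> b = b'" by (metis insert_iff insert_ident prod.inject)
  qed
  show "(\<lambda>(R, b). insert (a, b) R) ` (SIGMA R:rook_placements A B. B - Range R)
    = {S \<in> rook_placements (insert a A) B. a \<in> Domain S}" (is "?L = ?R")
  proof (intro equalityI subsetI)
    fix S assume "S \<in> ?L"
    then obtain R b where "R \<in> rook_placements A B" "b \<in> B - Range R" "S = insert (a, b) R"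
      by auto
    with not_in_Domain show "S \<in> ?R"
      by (auto simp: rook_placements_def single_valued_def)
  next
    fix S assume "S \<in> ?R"
    then obtain b where S: "S \<in> rook_placements (insert a A) B" and b: "(a, b) \<in> S" by blast
    have "S - {(a, b)} \<in> rook_placements A B" "b \<in> B - Range (S - {(a, b)})"
      using S b by (auto simp: rook_placements_def single_valued_def)
    then show "S \<in> ?L"
      using b by (intro image_eqI[of _ _ "(S - {(a, b)}, b)"]) auto
  qed
qed

lemma sum_rook_placements_insert_row:
  fixes g :: "('a \<times> 'b) set \<Rightarrow> 'c::comm_monoid_add"
  assumes "finite A" "finite B" "a \<notin> A"
  shows "(\<Sum>S\<in>rook_placements (insert a A) B. g S)
    = (\<Sum>R\<in>rook_placements A B. g R + (\<Sum>b\<in>B - Range R. g (insert (a, b) R)))"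
proof -
  let ?S = "rook_placements (insert a A) B"
  have "(\<Sum>S\<in>?S. g S) = sum g {S \<in> ?S. a \<notin> Domain S} + sum g {S \<in> ?S. a \<in> Domain S}"
    using assms by (subst sum.union_disjoint[symmetric])
      (auto simp: finite_rook_placements intro: sum.cong)
  also have "{S \<in> ?S. a \<notin> Domain S} = rook_placements A B"
    using assms(3) by (auto simp: rook_placements_def)
  also have "sum g {S \<in> ?S. a \<in> Domain S}
      = (\<Sum>(R, b)\<in>(SIGMA R:rook_placements A B. B - Range R). g (insert (a, b) R))"
    by (simp add: sum.reindex_bij_betw[OF bij_betw_insert_rook[OF assms(3)], symmetric]
        case_prod_beta)
  also have "\<dots> = (\<Sum>R\<in>rook_placements A B. \<Sum>b\<in>B - Range R. g (insert (a, b) R))"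
    using assms by (simp add: sum.Sigma finite_rook_placements)
  finally show ?thesis by (simp add: sum.distrib)
qed

lemma sum_rook_placements_converse:
  "(\<Sum>R\<in>rook_placements A B. g (R\<inverse>)) = (\<Sum>R\<in>rook_placements B A. g R)"
  by (rule sum.reindex_bij_witness[of _ converse converse])
    (auto simp: converse_in_rook_placements_iff)

lemma sum_rook_placements_insert_column:
  fixes g :: "('a \<times> 'b) set \<Rightarrow> 'c::comm_monoid_add"
  assumes "finite A" "finite B" "b \<notin> B"
  shows "(\<Sum>S\<in>rook_placements A (insert b B). g S)
    = (\<Sum>R\<in>rook_placements A B. g R + (\<Sum>a\<in>A - Domain R. g (insert (a, b) R)))"
proof -
  have "(\<Sum>S\<in>rook_placements A (insert b B). g S)
      = (\<Sum>S\<in>rook_placements (insert b B) A. g (S\<inverse>))"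
    by (rule sum_rook_placements_converse[symmetric])
  also have "\<dots> = (\<Sum>R\<in>rook_placements B A. g (R\<inverse>) + (\<Sum>a\<in>A - Domain (R\<inverse>). g (insert (a, b) (R\<inverse>))))"
    using assms by (simp add: sum_rook_placements_insert_row converse_insert)
  also have "\<dots> = (\<Sum>R\<in>rook_placements A B. g R + (\<Sum>a\<in>A - Domain R. g (insert (a, b) R)))"
    by (rule sum_rook_placements_converse)
  finally show ?thesis .
qed

lemma sum_rook_placements_insert_row_column:
  fixes g :: "('a \<times> 'b) set \<Rightarrow> 'c::comm_monoid_add"
  assumes "finite A" "finite B" "a \<notin> A" "b \<notin> B"
  shows "(\<Sum>S\<in>rook_placements (insert a A) (insert b B). g S) =
    (\<Sum>R\<in>rook_placements A B.
        g R + (\<Sum>i\<in>insert a A - Domain R. g (insert (i, b) R))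
        + (\<Sum>j\<in>B - Range R. g (insert (a, j) R))
        + (\<Sum>j\<in>B - Range R. \<Sum>i\<in>A - Domain R. g (insert (i, b) (insert (a, j) R))))"
proof -
  have "insert a A - insert a D = A - D" for D
    using assms(3) by auto
  with assms show ?thesis
    by (simp add: sum_rook_placements_insert_column sum_rook_placements_insert_row sum.distrib
        ac_simps)
qed

section \<open>Permutations as full rook placements\<close>

definition graph_on :: "'a set \<Rightarrow> ('a \<Rightarrow> 'b) \<Rightarrow> ('a \<times> 'b) set" where
  "graph_on A f = (\<lambda>a. (a, f a)) ` A"

lemma graph_on_iff: "(a, b) \<in> graph_on A f \<longleftrightarrow> a \<in> A \<and> b = f a"
  by (auto simp: graph_on_def)

lemma card_graph_on: "card (graph_on A f) = card A"
  unfolding graph_on_def by (rule card_image) (simp add: inj_on_def)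

lemma graph_on_in_rook_placements_iff:
  "graph_on A f \<in> rook_placements A B \<longleftrightarrow> inj_on f A \<and> f ` A \<subseteq> B"
proof -
  have "single_valued (graph_on A f)" "single_valued ((graph_on A f)\<inverse>) \<longleftrightarrow> inj_on f A"
    by (auto simp: single_valued_def inj_on_def graph_on_iff)
  moreover have "graph_on A f \<subseteq> A \<times> B \<longleftrightarrow> f ` A \<subseteq> B"
    unfolding graph_on_def by blast
  ultimately show ?thesis by (auto simp: rook_placements_def)
qed

lemma rook_placement_eq_graph_on:
  assumes "R \<in> rook_placements A B" "finite A" "card R = card A"
  obtains f where "R = graph_on A f"
proof -
  have "Domain R = A"
    using assms card_free_rows[OF assms(1,2)] by (auto simp: rook_placements_def)
  then have "\<forall>a\<in>A. \<exists>b. (a, b) \<in> R" by blast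
  then obtain f where f: "\<forall>a\<in>A. (a, f a) \<in> R" by metis
  have "R = graph_on A f"
    using f assms(1) by (force simp: graph_on_iff rook_placements_def dest: single_valuedD)
  then show thesis by (rule that)
qed

lemma bij_betw_graph_on:
  assumes "finite A"
  shows "bij_betw (graph_on A) {\<sigma>. \<sigma> permutes A} {R \<in> rook_placements A A. card R = card A}"
proof (rule bij_betw_imageI)
  show "inj_on (graph_on A) {\<sigma>. \<sigma> permutes A}"
  proof (rule inj_onI, clarify)
    fix \<sigma> \<tau> assume "\<sigma> permutes A" "\<tau> permutes A" and eq: "graph_on A \<sigma> = graph_on A \<tau>"
    moreover have "\<sigma> a = \<tau> a" if "a \<in> A" for a
      using eq that by (metis graph_on_iff)
    ultimately show "\<sigma> = \<tau>"
      by (metis ext permutes_not_in)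
  qed
  show "graph_on A ` {\<sigma>. \<sigma> permutes A} = {R \<in> rook_placements A A. card R = card A}" (is "?L = ?R")
  proof (intro equalityI subsetI)
    fix R assume "R \<in> ?L"
    then show "R \<in> ?R"
      by (auto simp: graph_on_in_rook_placements_iff card_graph_on permutes_inj_on
          permutes_in_image)
  next
    fix R assume R: "R \<in> ?R"
    then obtain f where f: "R = graph_on A f"
      using rook_placement_eq_graph_on[OF _ assms] by blast
    have "bij_betw f A A"
      using R assms by (auto simp: f graph_on_in_rook_placements_iff bij_betw_def endo_inj_surj)
    moreover have "R = graph_on A (restrict_id f A)"
      by (auto simp: f graph_on_iff)
    ultimately show "R \<in> ?L"
      by (auto intro: permutes_restrict_id)
  qed
qed

section \<open>Weighted rook placements on square boards\<close>

abbreviation square_placements :: "nat \<Rightarrow> (nat \<times> nat) set set" where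
  "square_placements n \<equiv> rook_placements {1..n} {1..n}"

definition height :: "nat \<Rightarrow> (nat \<times> nat) set \<Rightarrow> nat" where
  "height n R = n - card R"

lemma
  assumes "R \<in> square_placements n"
  shows card_rows_eq_height: "card ({1..n} - Domain R) = height n R"
    and card_columns_eq_height: "card ({1..n} - Range R) = height n R"
    and card_rows_Suc_eq_height: "card ({1..Suc n} - Domain R) = Suc (height n R)"
proof -
  show "card ({1..n} - Domain R) = height n R" "card ({1..n} - Range R) = height n R"
    using card_free_rows[OF assms] card_free_columns[OF assms] by (simp_all add: height_def)
  have "R \<in> rook_placements {1..Suc n} {1..n}"
    using assms by (auto simp: rook_placements_def)
  from card_free_rows[OF this] show "card ({1..Suc n} - Domain R) = Suc (height n R)"
    using card_rook_placement_le[OF assms] by (simp add: height_def Suc_diff_le)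
qed

lemma height_eq_0_iff: "R \<in> square_placements n \<Longrightarrow> height n R = 0 \<longleftrightarrow> card R = n"
  using card_rook_placement_le[of R "{1..n}" "{1..n}"] by (auto simp: height_def)

lemma
  assumes "R \<in> square_placements n"
  shows height_Suc: "height (Suc n) R = Suc (height n R)"
    and height_Suc_insert_column: "height (Suc n) (insert (i, Suc n) R) = height n R"
    and height_Suc_insert_row: "height (Suc n) (insert (Suc n, j) R) = height n R"
    and height_Suc_insert_both:
      "i \<le> n \<Longrightarrow> height (Suc n) (insert (i, Suc n) (insert (Suc n, j) R)) = height n R - 1"
proof -
  have "(i, Suc n) \<notin> R" "(Suc n, j) \<notin> R" "finite R" "card R \<le> n" for i j
    using rook_placements_subset[OF assms] finite_rook_placement[OF assms]
      card_rook_placement_le[OF assms] by auto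
  then show "height (Suc n) R = Suc (height n R)"
    and "height (Suc n) (insert (i, Suc n) R) = height n R"
    and "height (Suc n) (insert (Suc n, j) R) = height n R"
    and "i \<le> n \<Longrightarrow> height (Suc n) (insert (i, Suc n) (insert (Suc n, j) R)) = height n R - 1"
    by (auto simp: height_def)
qed

abbreviation corner :: "nat \<Rightarrow> (nat \<Rightarrow> nat) \<Rightarrow> nat \<Rightarrow> (nat \<times> nat) set" where
  "corner n \<sigma> m \<equiv> Restr (graph_on {1..n} \<sigma>) {1..m}"

text \<open>The weight is built up one row and column at a time, and a placement is at height \<open>k\<close> of a
  Motzkin path; the three assumptions say that its up, level and down steps have total weights \<open>1\<close>,
  \<open>\<gamma> k\<close> and \<open>\<beta> k\<close>.\<close>

locale rook_weight =
  fixes w :: "nat \<Rightarrow> (nat \<times> nat) set \<Rightarrow> 'a::comm_ring_1" and \<gamma> \<beta> :: "nat \<Rightarrow> 'a"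
  assumes weight_up: "R \<in> square_placements n \<Longrightarrow> w (Suc n) R = 1"
    and weight_level: "R \<in> square_placements n \<Longrightarrow>
        (\<Sum>i\<in>{1..Suc n} - Domain R. w (Suc n) (insert (i, Suc n) R))
        + (\<Sum>j\<in>{1..n} - Range R. w (Suc n) (insert (Suc n, j) R)) = \<gamma> (height n R)"
    and weight_down: "R \<in> square_placements n \<Longrightarrow> height n R > 0 \<Longrightarrow>
        (\<Sum>j\<in>{1..n} - Range R. \<Sum>i\<in>{1..n} - Domain R.
          w (Suc n) (insert (i, Suc n) (insert (Suc n, j) R))) = \<beta> (height n R)"
begin

definition weight :: "nat \<Rightarrow> (nat \<times> nat) set \<Rightarrow> 'a" where
  "weight n R = (\<Prod>m=1..n. w m (Restr R {1..m}))"

lemma weight_Suc: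
  assumes "S \<subseteq> {1..Suc n} \<times> {1..Suc n}" "Restr S {1..n} = R"
  shows "weight (Suc n) S = weight n R * w (Suc n) S"
proof -
  have "Restr R {1..m} = Restr S {1..m}" if "m \<le> n" for m
    using that by (subst assms(2)[symmetric]) auto
  moreover have "Restr S {1..Suc n} = S"
    using assms(1) by auto
  ultimately show ?thesis by (simp add: weight_def)
qed

context
  fixes n :: nat and R :: "(nat \<times> nat) set" and h :: "nat \<Rightarrow> 'a"
  assumes R: "R \<in> square_placements n"
begin

lemma weight_extension_mult:
  assumes "S \<subseteq> {1..Suc n} \<times> {1..Suc n}" "Restr S {1..n} = R" "height (Suc n) S = k"
  shows "weight (Suc n) S * h (height (Suc n) S) = weight n R * h k * w (Suc n) S"
  by (simp add: weight_Suc[OF assms(1,2)] assms(3) ac_simps)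

lemma weight_up_step:
  "weight (Suc n) R * h (height (Suc n) R) = weight n R * h (Suc (height n R))"
  using rook_placements_subset[OF R] height_Suc[OF R]
  by (subst weight_extension_mult[of _ "Suc (height n R)"]) (auto simp: weight_up[OF R])

lemma sum_weight_level_steps:
  "(\<Sum>i\<in>{1..Suc n} - Domain R.
        weight (Suc n) (insert (i, Suc n) R) * h (height (Suc n) (insert (i, Suc n) R)))
    + (\<Sum>j\<in>{1..n} - Range R.
        weight (Suc n) (insert (Suc n, j) R) * h (height (Suc n) (insert (Suc n, j) R)))
    = weight n R * (\<gamma> (height n R) * h (height n R))" (is "?columns + ?rows = _")
proof -
  let ?c = "weight n R * h (height n R)"
  have "?columns = ?c * (\<Sum>i\<in>{1..Suc n} - Domain R. w (Suc n) (insert (i, Suc n) R))"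
    unfolding sum_distrib_left using rook_placements_subset[OF R]
    by (intro sum.cong refl weight_extension_mult height_Suc_insert_column[OF R]) auto
  moreover have "?rows = ?c * (\<Sum>j\<in>{1..n} - Range R. w (Suc n) (insert (Suc n, j) R))"
    unfolding sum_distrib_left using rook_placements_subset[OF R]
    by (intro sum.cong refl weight_extension_mult height_Suc_insert_row[OF R]) auto
  ultimately have "?columns + ?rows = ?c * \<gamma> (height n R)"
    by (simp only: weight_level[OF R] flip: distrib_left)
  then show ?thesis
    by (simp only: ac_simps)
qed

lemma sum_weight_down_steps:
  "(\<Sum>j\<in>{1..n} - Range R. \<Sum>i\<in>{1..n} - Domain R.
        weight (Suc n) (insert (i, Suc n) (insert (Suc n, j) R))
        * h (height (Suc n) (insert (i, Suc n) (insert (Suc n, j) R))))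
    = weight n R * (if height n R = 0 then 0 else \<beta> (height n R) * h (height n R - 1))"
    (is "?steps = _")
proof (cases "height n R = 0")
  case True
  then have "{1..n} - Range R = {}"
    using card_columns_eq_height[OF R] by simp
  then have "?steps = 0" by (simp only: sum.empty)
  then show ?thesis using True by simp
next
  case False
  have "?steps = (\<Sum>j\<in>{1..n} - Range R. \<Sum>i\<in>{1..n} - Domain R.
      weight n R * h (height n R - 1) * w (Suc n) (insert (i, Suc n) (insert (Suc n, j) R)))"
    using rook_placements_subset[OF R]
    by (intro sum.cong refl weight_extension_mult height_Suc_insert_both[OF R]) auto
  also have "\<dots> = weight n R * h (height n R - 1) * \<beta> (height n R)"
    using False by (simp only: weight_down[OF R] neq0_conv flip: sum_distrib_left)
  finally show ?thesis
    using False by (simp add: ac_simps)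
qed

end

lemma sum_weight_Suc:
  "(\<Sum>S\<in>square_placements (Suc n). weight (Suc n) S * h (height (Suc n) S))
    = (\<Sum>R\<in>square_placements n. weight n R * (h (Suc (height n R)) + \<gamma> (height n R) * h (height n R)
        + (if height n R = 0 then 0 else \<beta> (height n R) * h (height n R - 1))))"
proof -
  define g where "g S = weight (Suc n) S * h (height (Suc n) S)" for S
  have "{1..Suc n} = insert (Suc n) {1..n}"
    by (simp add: atLeastAtMostSuc_conv)
  then have "sum g (square_placements (Suc n)) = (\<Sum>R\<in>square_placements n. g R
      + (\<Sum>i\<in>{1..Suc n} - Domain R. g (insert (i, Suc n) R))
      + (\<Sum>j\<in>{1..n} - Range R. g (insert (Suc n, j) R))
      + (\<Sum>j\<in>{1..n} - Range R. \<Sum>i\<in>{1..n} - Domain R.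
          g (insert (i, Suc n) (insert (Suc n, j) R))))"
    by (simp only:) (rule sum_rook_placements_insert_row_column; simp)
  also have "\<dots> = (\<Sum>R\<in>square_placements n. weight n R * (h (Suc (height n R))
      + \<gamma> (height n R) * h (height n R)
      + (if height n R = 0 then 0 else \<beta> (height n R) * h (height n R - 1))))"
  proof (rule sum.cong[OF refl])
    fix R assume "R \<in> square_placements n"
    note steps = weight_up_step[OF this, of h] sum_weight_level_steps[OF this, of h]
      sum_weight_down_steps[OF this, of h]
    show "g R + (\<Sum>i\<in>{1..Suc n} - Domain R. g (insert (i, Suc n) R))
        + (\<Sum>j\<in>{1..n} - Range R. g (insert (Suc n, j) R))
        + (\<Sum>j\<in>{1..n} - Range R. \<Sum>i\<in>{1..n} - Domain R.
            g (insert (i, Suc n) (insert (Suc n, j) R)))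
      = weight n R * (h (Suc (height n R)) + \<gamma> (height n R) * h (height n R)
        + (if height n R = 0 then 0 else \<beta> (height n R) * h (height n R - 1)))"
      unfolding distrib_left steps[symmetric] g_def by (simp only: add.assoc)
  qed
  finally show ?thesis unfolding g_def .
qed

text \<open>A placement on \<open>[n]\<^sup>2\<close> stands for the first \<open>n\<close> steps of a Motzkin path, which are followed by
  \<open>r\<close> further steps that end at height \<open>0\<close>.\<close>

lemma sum_weight_motzkin_sum:
  "(\<Sum>R\<in>square_placements n. weight n R * motzkin_sum \<gamma> \<beta> r (height n R))
    = motzkin_sum \<gamma> \<beta> (n + r) 0"
proof (induction n arbitrary: r)
  case 0
  have "square_placements 0 = {{}}" by (auto simp: rook_placements_def)
  then show ?case by (simp add: weight_def height_def)
next
  case (Suc n)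
  show ?case
    unfolding sum_weight_Suc using Suc.IH[of "Suc r"] by simp
qed

theorem permutation_sum_eq_jfrac:
  "Abs_fps (\<lambda>n. \<Sum>\<sigma> | \<sigma> permutes {1..n}. \<Prod>m=1..n. w m (corner n \<sigma> m)) = jfrac \<gamma> \<beta>"
proof -
  have "(\<Sum>\<sigma> | \<sigma> permutes {1..n}. weight n (graph_on {1..n} \<sigma>)) = motzkin_sum \<gamma> \<beta> n 0" for n
  proof -
    have "(\<Sum>\<sigma> | \<sigma> permutes {1..n}. weight n (graph_on {1..n} \<sigma>))
        = (\<Sum>R | R \<in> square_placements n \<and> card R = n. weight n R)"
      using sum.reindex_bij_betw[OF bij_betw_graph_on[of "{1..n}"]] by simp
    also have "\<dots> = (\<Sum>R\<in>square_placements n. weight n R * motzkin_sum \<gamma> \<beta> 0 (height n R))"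
      by (intro sum.mono_neutral_cong_left) (auto simp: finite_rook_placements height_eq_0_iff)
    also have "\<dots> = motzkin_sum \<gamma> \<beta> n 0"
      using sum_weight_motzkin_sum[of n 0] by simp
    finally show ?thesis .
  qed
  then show ?thesis
    by (simp add: jfrac_eq_motzkin_sum weight_def)
qed

end

abbreviation (input) level_coeff :: "'a::comm_ring_1 \<Rightarrow> nat \<Rightarrow> 'a" where
  "level_coeff x \<equiv> (\<lambda>n. (of_nat n + 1) + of_nat n * x)"

abbreviation (input) down_coeff :: "'a::comm_ring_1 \<Rightarrow> nat \<Rightarrow> 'a" where
  "down_coeff x \<equiv> (\<lambda>n. of_nat n * (1 + (of_nat n - 1) * x))"

section \<open>Paths and cycles of partial bijections\<close>

lemma ex1_path_source:
  assumes "finite R" "single_valued R" "single_valued (R\<inverse>)" and b: "b \<notin> Domain R"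
  shows "\<exists>!a. a \<notin> Range R \<and> (a, b) \<in> R\<^sup>*"
proof (rule ex_ex1I)
  define A where "A = {a. (a, b) \<in> R\<^sup>*}"
  have "A \<subseteq> insert b (Domain R)"
    by (auto simp: A_def elim: converse_rtranclE)
  then have "finite A"
    using assms(1) by (auto intro: finite_subset finite_Domain)
  show "\<exists>a. a \<notin> Range R \<and> (a, b) \<in> R\<^sup>*"
  proof (rule ccontr)
    assume "\<not> ?thesis"
    then have "\<forall>a\<in>A. \<exists>p. (p, a) \<in> R"
      unfolding A_def by blast
    then obtain p where p: "\<And>a. a \<in> A \<Longrightarrow> (p a, a) \<in> R" by metis
    have "p ` A \<subseteq> A"
      using p by (auto simp: A_def intro: converse_rtrancl_into_rtrancl)
    moreover have "inj_on p A"
      using p assms(2) by (metis inj_onI single_valuedD)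
    ultimately have "p ` A = A" using \<open>finite A\<close> by (simp add: endo_inj_surj)
    moreover have "b \<in> A" by (simp add: A_def)
    ultimately show False using p b by (metis DomainI imageE)
  qed
next
  fix a a' assume "a \<notin> Range R \<and> (a, b) \<in> R\<^sup>*" "a' \<notin> Range R \<and> (a', b) \<in> R\<^sup>*"
  moreover from this have "(a, a') \<in> (R\<inverse>)\<^sup>* \<or> (a', a) \<in> (R\<inverse>)\<^sup>*"
    by (intro single_valued_confluent[OF assms(3), of b]) (simp_all add: rtrancl_converse)
  ultimately show "a = a'"
    by (auto simp: rtrancl_converse elim: rtranclE)
qed

lemma ex1_free_column_reaching:
  assumes R: "R \<in> rook_placements A A" and "finite A" and i: "i \<in> A - Domain R"
  shows "\<exists>!j. j \<in> A - Range R \<and> (j, i) \<in> R\<^sup>*"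
proof -
  have "\<exists>!j. j \<notin> Range R \<and> (j, i) \<in> R\<^sup>*"
    using assms
    by (intro ex1_path_source) (auto intro: finite_rook_placement simp: rook_placements_def)
  moreover have "j \<in> A" if "(j, i) \<in> R\<^sup>*" for j
    using that by (cases rule: converse_rtranclE) (use i rook_placements_subset[OF R] in auto)
  ultimately show ?thesis by auto
qed

lemma self_trancl_insert_insert_iff:
  assumes "m \<notin> Field R" "i \<noteq> m" "j \<noteq> m"
  shows "(m, m) \<in> (insert (i, m) (insert (m, j) R))\<^sup>+ \<longleftrightarrow> (j, i) \<in> R\<^sup>*"
proof -
  have "(m, b) \<in> R\<^sup>* \<longleftrightarrow> b = m" "(b, m) \<in> R\<^sup>* \<longleftrightarrow> b = m" "(m, b) \<notin> R\<^sup>+" for b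
    using assms(1) by (auto simp: Field_def elim: converse_rtranclE rtranclE tranclE dest: tranclD)
  then show ?thesis
    using assms by (auto simp: trancl_insert rtrancl_insert)
qed

lemma single_valued_cycle_sym:
  assumes "single_valued R" and cycle: "(a, a) \<in> R\<^sup>+" and "(a, b) \<in> R\<^sup>+"
  shows "(b, a) \<in> R\<^sup>+"
proof -
  have step: "(c, a) \<in> R\<^sup>+" if "(b, a) \<in> R\<^sup>+" "(b, c) \<in> R" for b c
  proof -
    from that assms(1) have "(c, a) \<in> R\<^sup>*" by (metis single_valuedD tranclD)
    then show ?thesis using cycle by (rule rtrancl_trancl_trancl)
  qed
  from assms(3) show ?thesis
    by induction (auto intro: step cycle)
qed

lemma self_trancl_Restr_graph_on_iff:
  assumes "A \<subseteq> B"
  shows "(a, a) \<in> (Restr (graph_on B f) A)\<^sup>+ \<longleftrightarrow> a \<in> orbit f a \<and> orbit f a \<subseteq> A"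
proof -
  define C where "C = Restr (graph_on B f) A"
  have C_iff: "(b, c) \<in> C \<longleftrightarrow> b \<in> A \<and> c \<in> A \<and> c = f b" for b c
    using assms by (auto simp: C_def graph_on_iff)
  then have single_valued_C: "single_valued C"
    by (auto simp: single_valued_def)
  show ?thesis
    unfolding C_def[symmetric]
  proof (intro iffI conjI subsetI; (elim conjE)?)
    assume cycle: "(a, a) \<in> C\<^sup>+"
    have "b \<in> orbit f a" if "(a, b) \<in> C\<^sup>+" for b
      using that by induction (auto simp: C_iff intro: orbit.intros)
    with cycle show "a \<in> orbit f a" by blast
    fix b assume "b \<in> orbit f a"
    then have "(a, b) \<in> C\<^sup>+"
    proof induction
      case base
      from cycle show ?case by (metis C_iff tranclD r_into_trancl)
    next
      case (step b)
      have "(b, a) \<in> C\<^sup>+"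
        by (rule single_valued_cycle_sym[OF single_valued_C cycle step.IH])
      with step.IH show ?case by (metis C_iff tranclD trancl_into_trancl)
    qed
    then show "b \<in> A" by (metis C_iff tranclD2)
  next
    assume self: "a \<in> orbit f a" and sub: "orbit f a \<subseteq> A"
    have edge: "(b, f b) \<in> C" if "b \<in> orbit f a" for b
      using that sub by (auto simp: C_iff intro: orbit.step)
    have "(a, b) \<in> C\<^sup>+" if "b \<in> orbit f a" for b
      using that by induction (auto intro: edge self trancl_into_trancl)
    then show "(a, a) \<in> C\<^sup>+" using self .
  qed
qed

section \<open>Drops at the extremes of the cycles of a permutation\<close>

lemma bij_betw_orbit_representatives:
  assumes \<sigma>: "permutation \<sigma>" and rep: "\<And>X. finite X \<Longrightarrow> X \<noteq> {} \<Longrightarrow> rep X \<in> X"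
  shows "bij_betw (orbit \<sigma>) {a. \<sigma> a \<noteq> a \<and> a = rep (orbit \<sigma> a)} (orbit \<sigma> ` {a. \<sigma> a \<noteq> a})"
proof (rule bij_betw_imageI)
  show "inj_on (orbit \<sigma>) {a. \<sigma> a \<noteq> a \<and> a = rep (orbit \<sigma> a)}"
    by (rule inj_onI) auto
  show "orbit \<sigma> ` {a. \<sigma> a \<noteq> a \<and> a = rep (orbit \<sigma> a)} = orbit \<sigma> ` {a. \<sigma> a \<noteq> a}"
  proof (intro equalityI subsetI)
    fix X assume "X \<in> orbit \<sigma> ` {a. \<sigma> a \<noteq> a}"
    then obtain a where a: "X = orbit \<sigma> a" "\<sigma> a \<noteq> a" by auto
    have self: "a \<in> orbit \<sigma> a" by (rule permutation_self_in_orbit[OF \<sigma>])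
    define b where "b = rep (orbit \<sigma> a)"
    have "b \<in> orbit \<sigma> a"
      unfolding b_def using finite_orbit[OF self] self by (intro rep) auto
    then have orbit_b: "orbit \<sigma> b = orbit \<sigma> a"
      by (rule orbit_cyclic_eq3[OF cyclic_on_orbit'[OF \<sigma>]])
    then have "\<sigma> b \<noteq> b"
      using a(2) self orbit_eq_singleton_iff[of \<sigma> b] by auto
    then show "X \<in> orbit \<sigma> ` {a. \<sigma> a \<noteq> a \<and> a = rep (orbit \<sigma> a)}"
      using orbit_b by (intro image_eqI[of _ _ b]) (simp_all add: a(1) b_def)
  qed auto
qed

lemma card_drops_to_Min_eq_card_drops_from_Max:
  fixes \<sigma> :: "'a::linorder \<Rightarrow> 'a"
  assumes \<sigma>: "permutation \<sigma>"
  shows "card {i. \<sigma> i < i \<and> \<sigma> i = Min (orbit \<sigma> (\<sigma> i))} = card {i. \<sigma> i < i \<and> i = Max (orbit \<sigma> i)}"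
    (is "card ?to_Min = card ?from_Max")
proof -
  have self: "i \<in> orbit \<sigma> i" for i by (rule permutation_self_in_orbit[OF \<sigma>])
  have fin: "finite (orbit \<sigma> i)" for i by (rule finite_orbit[OF self])
  have inj: "inj \<sigma>" using \<sigma> by (simp add: permutation_bijective bij_is_inj)
  have "\<sigma> ` ?to_Min = {a. \<sigma> a \<noteq> a \<and> a = Min (orbit \<sigma> a)}"
  proof (intro equalityI subsetI)
    fix a assume a: "a \<in> {a. \<sigma> a \<noteq> a \<and> a = Min (orbit \<sigma> a)}"
    obtain i where i: "a = \<sigma> i" "i \<in> orbit \<sigma> a"
      using self[of a] by (cases rule: orbit.cases) (use self in auto)
    have "\<sigma> i \<le> i" using a i fin by (metis (mono_tags, lifting) Min_le mem_Collect_eq)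
    then show "a \<in> \<sigma> ` ?to_Min" using a i by (auto simp: order.order_iff_strict)
  qed (auto dest: injD[OF inj])
  then have "card ?to_Min = card {a. \<sigma> a \<noteq> a \<and> a = Min (orbit \<sigma> a)}"
    using card_image[of \<sigma> ?to_Min] inj by (simp add: inj_on_subset)
  also have "\<dots> = card (orbit \<sigma> ` {a. \<sigma> a \<noteq> a})"
    by (rule bij_betw_same_card[OF bij_betw_orbit_representatives[OF \<sigma> Min_in]])
  also have "\<dots> = card {a. \<sigma> a \<noteq> a \<and> a = Max (orbit \<sigma> a)}"
    by (rule bij_betw_same_card[OF bij_betw_orbit_representatives[OF \<sigma> Max_in], symmetric])
  also have "{a. \<sigma> a \<noteq> a \<and> a = Max (orbit \<sigma> a)} = ?from_Max"
    using Max_ge[OF fin orbit.base] by (intro Collect_cong) (metis order.strict_iff_order)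
  finally show ?thesis .
qed

lemma card_drops_not_to_Min_eq_card_drops_not_from_Max:
  fixes \<sigma> :: "'a::linorder \<Rightarrow> 'a"
  assumes \<sigma>: "permutation \<sigma>"
  shows "card {i. \<sigma> i < i \<and> \<sigma> i \<noteq> Min (orbit \<sigma> (\<sigma> i))} = card {i. \<sigma> i < i \<and> i \<noteq> Max (orbit \<sigma> i)}"
proof -
  have fin: "finite {i. \<sigma> i < i}"
    by (rule finite_subset[OF _ permutation_finite_support[OF \<sigma>]]) auto
  have complement: "card {i. \<sigma> i < i \<and> \<not> P i} = card {i. \<sigma> i < i} - card {i. \<sigma> i < i \<and> P i}" for P
    using fin by (subst card_Diff_subset[symmetric]) (auto intro: arg_cong[of _ _ card])
  show ?thesis
    by (simp only: complement card_drops_to_Min_eq_card_drops_from_Max[OF \<sigma>])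
qed

section \<open>Weak excedances in the middle of a decreasing triple\<close>

lemma ex_smaller_after_if_larger_before:
  fixes \<sigma> :: "nat \<Rightarrow> nat"
  assumes \<sigma>: "\<sigma> permutes {1..n}" and i: "i \<in> {1..<j}" "\<sigma> i > \<sigma> j" and j: "j \<in> {1..n}" "j \<le> \<sigma> j"
  shows "\<exists>k\<in>{1..n}. j < k \<and> \<sigma> k < \<sigma> j"
proof (rule ccontr)
  assume none: "\<not> ?thesis"
  have "\<sigma> k \<in> {\<sigma> j<..n}" if "k \<in> insert i {j<..n}" for k
  proof -
    have k: "k \<in> {1..n}" "k \<noteq> j" using that i j by auto
    then have "\<sigma> k \<in> {1..n}" "\<sigma> k \<noteq> \<sigma> j"
      using \<sigma> permutes_in_image[OF \<sigma>] by (auto dest: permutes_inj injD)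
    moreover have "\<not> \<sigma> k < \<sigma> j" using none k that i(2) by auto
    ultimately show ?thesis by auto
  qed
  then have "card (\<sigma> ` insert i {j<..n}) \<le> card {\<sigma> j<..n}"
    by (intro card_mono) auto
  moreover have "card (\<sigma> ` insert i {j<..n}) = card (insert i {j<..n})"
    by (rule card_image) (rule permutes_inj_on[OF \<sigma>])
  moreover have "card (insert i {j<..n}) = Suc (n - j)"
    using i by simp
  ultimately show False using j(2) by simp
qed

text \<open>In the corner of a permutation \<open>\<sigma>\<close>, row \<open>i\<close> is free iff \<open>\<sigma> i > m\<close>; so with \<open>\<sigma> j = m\<close>
  this says that \<open>j\<close> is a weak excedance but not a left-to-right maximum.\<close>

definition wexx_at :: "nat \<Rightarrow> (nat \<times> nat) set \<Rightarrow> bool" where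
  "wexx_at m S \<longleftrightarrow> (\<exists>j. (j, m) \<in> S \<and> (\<exists>i\<in>{1..<j}. i \<notin> Domain S))"

lemma wexx_at_corner_iff:
  assumes \<sigma>: "\<sigma> permutes {1..n}" and j: "j \<in> {1..n}"
  shows "wexx_at (\<sigma> j) (corner n \<sigma> (\<sigma> j)) \<longleftrightarrow> j \<le> \<sigma> j \<and> (\<exists>i\<in>{1..<j}. \<sigma> i > \<sigma> j)"
proof -
  define S where "S = corner n \<sigma> (\<sigma> j)"
  have pos: "1 \<le> \<sigma> i" if "i \<in> {1..n}" for i
    using that permutes_in_image[OF \<sigma>, of i] by simp
  have column: "(i, \<sigma> j) \<in> S \<longleftrightarrow> i = j \<and> j \<le> \<sigma> j" for i
    using j pos[OF j] permutes_inj[OF \<sigma>] by (auto simp: S_def graph_on_iff inj_eq)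
  have row: "i \<notin> Domain S \<longleftrightarrow> \<sigma> i > \<sigma> j" if "j \<le> \<sigma> j" "i \<in> {1..<j}" for i
    using that j pos[of i] by (auto simp: S_def graph_on_iff Domain_iff)
  have "wexx_at (\<sigma> j) S \<longleftrightarrow> j \<le> \<sigma> j \<and> (\<exists>i\<in>{1..<j}. i \<notin> Domain S)"
    by (auto simp: wexx_at_def column)
  also have "\<dots> \<longleftrightarrow> j \<le> \<sigma> j \<and> (\<exists>i\<in>{1..<j}. \<sigma> i > \<sigma> j)"
    by (intro conj_cong bex_cong refl row)
  finally show ?thesis unfolding S_def .
qed

lemma wexx_eq_card_wexx_at:
  assumes \<sigma>: "\<sigma> permutes {1..n}"
  shows "wexx n \<sigma> = card {m \<in> {1..n}. wexx_at m (corner n \<sigma> m)}"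
proof -
  define W where "W = {j \<in> {1..n}. j \<le> \<sigma> j \<and> (\<exists>i\<in>{1..<j}. \<sigma> i > \<sigma> j)}"
  have "{j \<in> {1..n}. j \<le> \<sigma> j \<and>
      (\<exists>i\<in>{1..n}. \<exists>k\<in>{1..n}. i < j \<and> j < k \<and> \<sigma> i > \<sigma> j \<and> \<sigma> j > \<sigma> k)} = W"
    unfolding W_def
  proof (intro Collect_cong conj_cong refl iffI)
    fix j assume "j \<in> {1..n}" "j \<le> \<sigma> j" "\<exists>i\<in>{1..<j}. \<sigma> i > \<sigma> j"
    then show "\<exists>i\<in>{1..n}. \<exists>k\<in>{1..n}. i < j \<and> j < k \<and> \<sigma> i > \<sigma> j \<and> \<sigma> j > \<sigma> k"
      using ex_smaller_after_if_larger_before[OF \<sigma>, of _ j] by fastforce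
  qed auto
  then have "wexx n \<sigma> = card W"
    by (simp add: wexx_def)
  also have "\<dots> = card (\<sigma> ` W)"
    by (rule card_image[symmetric]) (rule permutes_inj_on[OF \<sigma>])
  also have "\<sigma> ` W = {m \<in> \<sigma> ` {1..n}. wexx_at m (corner n \<sigma> m)}"
    using wexx_at_corner_iff[OF \<sigma>] by (auto simp: W_def)
  finally show ?thesis
    by (simp only: permutes_image[OF \<sigma>])
qed

lemma rook_weight_wexx:
  fixes x :: "'a::comm_ring_1"
  shows "rook_weight (\<lambda>m S. if wexx_at m S then x else 1)
    (level_coeff x) (down_coeff x)"
proof
  fix n R assume R: "R \<in> square_placements n"
  let ?m = "Suc n" and ?k = "of_nat (height n R) :: 'a"
  have fresh: "(i, ?m) \<notin> R" "(?m, j) \<notin> R" for i j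
    using rook_placements_subset[OF R] by auto
  show "(if wexx_at ?m R then x else 1) = 1"
    by (simp add: wexx_at_def fresh)
  have column: "wexx_at ?m (insert (i, ?m) R) \<longleftrightarrow> (\<exists>i'\<in>{1..?m} - Domain R. i' < i)"
    if "i \<in> {1..?m} - Domain R" for i
    using that fresh by (auto simp: wexx_at_def)
  have row: "\<not> wexx_at ?m (insert (?m, j) R)" if "j \<in> {1..n}" for j
    using that fresh by (auto simp: wexx_at_def)
  have both: "wexx_at ?m (insert (i, ?m) (insert (?m, j) R)) \<longleftrightarrow> (\<exists>i'\<in>{1..n} - Domain R. i' < i)"
    if "i \<in> {1..n} - Domain R" "j \<in> {1..n}" for i j
    using that fresh by (auto simp: wexx_at_def)
  have "{1..?m} - Domain R \<noteq> {}"
    using fresh(2) by fastforce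
  then have "(\<Sum>i\<in>{1..?m} - Domain R. if wexx_at ?m (insert (i, ?m) R) then x else 1) = 1 + ?k * x"
    using sum_if_exists_smaller[of "{1..?m} - Domain R" x] card_rows_Suc_eq_height[OF R]
    by (simp add: column)
  then show "(\<Sum>i\<in>{1..?m} - Domain R. if wexx_at ?m (insert (i, ?m) R) then x else 1)
      + (\<Sum>j\<in>{1..n} - Range R. if wexx_at ?m (insert (?m, j) R) then x else 1)
      = (?k + 1) + ?k * x"
    using card_columns_eq_height[OF R] by (simp add: row)
  assume "height n R > 0"
  then have "{1..n} - Domain R \<noteq> {}"
    using card_rows_eq_height[OF R] by (metis card.empty less_irrefl)
  then have "(\<Sum>i\<in>{1..n} - Domain R. if \<exists>i'\<in>{1..n} - Domain R. i' < i then x else 1)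
      = 1 + (?k - 1) * x"
    using sum_if_exists_smaller[of "{1..n} - Domain R" x] card_rows_eq_height[OF R] by simp
  then show "(\<Sum>j\<in>{1..n} - Range R. \<Sum>i\<in>{1..n} - Domain R.
        if wexx_at ?m (insert (i, ?m) (insert (?m, j) R)) then x else 1) = ?k * (1 + (?k - 1) * x)"
    using card_columns_eq_height[OF R] by (simp add: both)
qed

section \<open>Cycle descents\<close>

definition cdes_at :: "nat \<Rightarrow> (nat \<times> nat) set \<Rightarrow> bool" where
  "cdes_at m S \<longleftrightarrow> (\<exists>v<m. (m, v) \<in> S) \<and> (m, m) \<notin> S\<^sup>+"

lemma cdes_at_corner_iff:
  assumes \<sigma>: "\<sigma> permutes {1..n}" and m: "m \<in> {1..n}"
  shows "cdes_at m (corner n \<sigma> m) \<longleftrightarrow> \<sigma> m < m \<and> m \<noteq> Max (orbit \<sigma> m)"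
proof -
  have self: "m \<in> orbit \<sigma> m"
    using \<sigma> by (intro permutation_self_in_orbit permutes_imp_permutation[of "{1..n}"]) auto
  have sub: "orbit \<sigma> m \<subseteq> {1..n}" by (rule permutes_orbit_subset[OF \<sigma> m])
  have "(m, m) \<in> (corner n \<sigma> m)\<^sup>+ \<longleftrightarrow> orbit \<sigma> m \<subseteq> {1..m}"
    using self m by (subst self_trancl_Restr_graph_on_iff) auto
  also have "\<dots> \<longleftrightarrow> m = Max (orbit \<sigma> m)"
    using self sub finite_orbit[OF self] by (subst eq_commute, subst Max_eq_iff) auto
  finally have cycle: "(m, m) \<in> (corner n \<sigma> m)\<^sup>+ \<longleftrightarrow> m = Max (orbit \<sigma> m)" .
  have "1 \<le> \<sigma> m" using permutes_in_image[OF \<sigma>, of m] m by simp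
  then have "(\<exists>v<m. (m, v) \<in> corner n \<sigma> m) \<longleftrightarrow> \<sigma> m < m"
    using m by (auto simp: graph_on_iff)
  with cycle show ?thesis by (simp only: cdes_at_def)
qed

lemma cdes_eq_card_cdes_at:
  assumes \<sigma>: "\<sigma> permutes {1..n}"
  shows "cdes n \<sigma> = card {m \<in> {1..n}. cdes_at m (corner n \<sigma> m)}"
proof -
  have "i \<in> {1..n}" if "\<sigma> i < i" for i
    using that permutes_not_in[OF \<sigma>, of i] by force
  then have drops: "{i \<in> {1..n}. \<sigma> i < i \<and> P i} = {i. \<sigma> i < i \<and> P i}" for P
    by blast
  have "permutation \<sigma>" using \<sigma> by (rule permutes_imp_permutation[rotated]) simp
  then have "cdes n \<sigma> = card {i \<in> {1..n}. \<sigma> i < i \<and> i \<noteq> Max (orbit \<sigma> i)}"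
    unfolding cdes_def drops by (rule card_drops_not_to_Min_eq_card_drops_not_from_Max)
  also have "{i \<in> {1..n}. \<sigma> i < i \<and> i \<noteq> Max (orbit \<sigma> i)}
      = {m \<in> {1..n}. cdes_at m (corner n \<sigma> m)}"
    using cdes_at_corner_iff[OF \<sigma>] by (intro Collect_cong conj_cong) auto
  finally show ?thesis .
qed

lemma rook_weight_cdes:
  fixes x :: "'a::comm_ring_1"
  shows "rook_weight (\<lambda>m S. if cdes_at m S then x else 1)
    (level_coeff x) (down_coeff x)"
proof
  fix n R assume R: "R \<in> square_placements n"
  let ?m = "Suc n" and ?k = "of_nat (height n R) :: 'a"
  have sub: "R \<subseteq> {1..n} \<times> {1..n}" by (rule rook_placements_subset[OF R])
  then have fresh: "(i, ?m) \<notin> R" "(?m, j) \<notin> R" "?m \<notin> Field R" for i j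
    by (auto simp: Field_def)
  show "(if cdes_at ?m R then x else 1) = 1"
    by (simp add: cdes_at_def fresh)
  have column: "\<not> cdes_at ?m (insert (i, ?m) R)" for i
    using fresh by (auto simp: cdes_at_def)
  have row: "cdes_at ?m (insert (?m, j) R)" if "j \<in> {1..n}" for j
  proof -
    have "?m \<notin> Range ((insert (?m, j) R)\<^sup>+)" using that fresh by auto
    moreover have "j < ?m" using that by simp
    ultimately show ?thesis unfolding cdes_at_def by blast
  qed
  have both: "cdes_at ?m (insert (i, ?m) (insert (?m, j) R)) \<longleftrightarrow> (j, i) \<notin> R\<^sup>*"
    if "i \<in> {1..n}" "j \<in> {1..n}" for i j
    using that fresh by (auto simp: cdes_at_def self_trancl_insert_insert_iff)
  show "(\<Sum>i\<in>{1..?m} - Domain R. if cdes_at ?m (insert (i, ?m) R) then x else 1)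
      + (\<Sum>j\<in>{1..n} - Range R. if cdes_at ?m (insert (?m, j) R) then x else 1)
      = (?k + 1) + ?k * x"
    using card_columns_eq_height[OF R] card_rows_Suc_eq_height[OF R] by (simp add: column row)
  have "(\<Sum>j\<in>{1..n} - Range R. if (j, i) \<notin> R\<^sup>* then x else 1) = 1 + (?k - 1) * x"
    if i: "i \<in> {1..n} - Domain R" for i
  proof -
    have "\<exists>!j. j \<in> {1..n} - Range R \<and> \<not> (j, i) \<notin> R\<^sup>*"
      using ex1_free_column_reaching[OF R _ i] by simp
    then show ?thesis
      by (subst sum_if_ex1_not)
        (simp_all only: card_columns_eq_height[OF R] finite_Diff finite_atLeastAtMost)
  qed
  then show "(\<Sum>j\<in>{1..n} - Range R. \<Sum>i\<in>{1..n} - Domain R.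
        if cdes_at ?m (insert (i, ?m) (insert (?m, j) R)) then x else 1) = ?k * (1 + (?k - 1) * x)"
    using card_rows_eq_height[OF R] by (subst sum.swap) (simp add: both)
qed

section \<open>The continued fractions\<close>

lemma wexx_poly_eq_jfrac:
  "Abs_fps wexx_poly = jfrac (level_coeff poly_x) (down_coeff poly_x)"
  unfolding rook_weight.permutation_sum_eq_jfrac[OF rook_weight_wexx, symmetric]
  by (simp add: fps_eq_iff wexx_poly_def wexx_eq_card_wexx_at prod_if_power)

lemma cdes_poly_eq_jfrac:
  "Abs_fps cdes_poly = jfrac (level_coeff poly_x) (down_coeff poly_x)"
  unfolding rook_weight.permutation_sum_eq_jfrac[OF rook_weight_cdes, symmetric]
  by (simp add: fps_eq_iff cdes_poly_def cdes_eq_card_cdes_at prod_if_power)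

lemma card_wexx_eq_coeff:
    "int (card {\<sigma>. \<sigma> permutes {1..n} \<and> wexx n \<sigma> = k}) = coeff (wexx_poly n) k"
  and card_cdes_eq_coeff:
    "int (card {\<sigma>. \<sigma> permutes {1..n} \<and> cdes n \<sigma> = k}) = coeff (cdes_poly n) k"
  by (simp_all add: wexx_poly_def cdes_poly_def coeff_sum_X_power finite_permutations)

theorem theorem3p9:
  shows "Abs_fps wexx_poly =
           jfrac (\<lambda>n. (of_nat n + 1) + of_nat n * poly_x)
                 (\<lambda>n. of_nat n * (1 + (of_nat n - 1) * poly_x)) \<and>
         Abs_fps cdes_poly =
           jfrac (\<lambda>n. (of_nat n + 1) + of_nat n * poly_x)
                 (\<lambda>n. of_nat n * (1 + (of_nat n - 1) * poly_x)) \<and>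
         (\<forall>n. wexx_poly n = cdes_poly n) \<and>
         (\<forall>n k. card {\<sigma>. \<sigma> permutes {1..n} \<and> wexx n \<sigma> = k} =
                card {\<sigma>. \<sigma> permutes {1..n} \<and> cdes n \<sigma> = k})"
proof -
  have "Abs_fps wexx_poly = Abs_fps cdes_poly"
    by (simp only: wexx_poly_eq_jfrac cdes_poly_eq_jfrac)
  then have polys_eq: "wexx_poly n = cdes_poly n" for n
    by (simp add: fps_eq_iff)
  then have "card {\<sigma>. \<sigma> permutes {1..n} \<and> wexx n \<sigma> = k}
      = card {\<sigma>. \<sigma> permutes {1..n} \<and> cdes n \<sigma> = k}" for n k
    using card_wexx_eq_coeff[of n k] card_cdes_eq_coeff[of n k] by simp
  then show ?thesis
    using wexx_poly_eq_jfrac cdes_poly_eq_jfrac polys_eq by blast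
qed

end
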